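(* Let $p$ be a positive prime integer, let $\mathbf{y}\in\mathbb{C}^p$ be such that $\widehat{\mathbf{y}}(0)\neq 0$, and let $$\Phi(p)=p-1=\prod_{i=1}^{k}q_i^{\alpha_i}$$ be the factorization of $\Phi(p)$ into prime powers, where the primes $q_1<q_2<\dots<q_k$ are distinct, $k\ge 1$ and $\alpha_i\ge 0$. Let $\epsilon$ be a generator of $\mathbb{U}_p$ and let $\Lambda$ be the set of all $k$-tuples of integers $(r_1,\dots,r_k)$ such that $0\le r_i\le\alpha_i$ for $i=1,\dots,k$, $\prod_{i=1}^k q_i^{r_i}\le\|\widehat{\mathbf{y}}\|_0-1$, and the matrix $\mathbf{Y}(\langle\epsilon^{\prod_{i=1}^k q_i^{r_i}}\rangle,\mathbf{y})$ has $\prod_{i=1}^k q_i^{r_i}$ nonzero rows. Then the set of all subgroups $\mathbb{M}$ of $\mathbb{U}_p$ for which the associated finite wavelet system $\mathcal{W}(\mathbf{y},\Delta_{\mathbb{M}})$, $\Delta_{\mathbb{M}}:=\mathbb{M}\times\mathbb{Z}_p$, is a frame for $\mathbb{C}^p$ consists of exactly those subgroups of the form $$\mathbb{M}=\langle\epsilon^{\prod_{i=1}^k q_i^{r_i-s_i}}\rangle,\qquad (r_1,\dots,r_k)\in\Lambda,\ 0\le s_i\le r_i,\ i=1,\dots,k.$$ Hence, the order of any such $\mathbb{M}$ is $$|\mathbb{M}|=\prod_{i=1}^k q_i^{\alpha_i-r_i+s_i}.$$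
   Context: $\mathbb{Z}_p=\{0,\dots,p-1\}$ is the cyclic group (field) of integers modulo $p$, and $\mathbb{U}_p=\mathbb{Z}_p\setminus\{0\}$ is its multiplicative group, which is cyclic of order $p-1$; $\Phi$ is Euler's totient function and $\langle g\rangle$ denotes the subgroup of $\mathbb{U}_p$ generated by $g$. $\mathbb{C}^p$ is the space of functions $\mathbf{x}:\mathbb{Z}_p\to\mathbb{C}$ with inner product $\langle\mathbf{x},\mathbf{y}\rangle=\sum_{k\in\mathbb{Z}_p}\mathbf{x}(k)\overline{\mathbf{y}(k)}$ and norm $\|\cdot\|_2$. The unitary discrete Fourier transform is $\widehat{\mathbf{x}}(\ell)=\frac{1}{\sqrt p}\sum_{k=0}^{p-1}\mathbf{x}(k)e^{-2\pi i\ell k/p}$. $\|\mathbf{x}\|_0=|\{k\in\mathbb{Z}_p:\mathbf{x}(k)\neq 0\}|$ counts nonzero entries. For $k\in\mathbb{Z}_p$ the translation operator on $\mathbb{C}^p$ is $T_k\mathbf{x}(s)=\mathbf{x}(s-k)$. For $m\in\mathbb{U}_p$ the cyclic dilation operator on $\mathbb{C}^p$ is $D_m\mathbf{x}(k)=\mathbf{x}(m_p k)$, where $m_p$ is the multiplicative inverse of $m$ in $\mathbb{U}_p$. For $\mathbf{y}\in\mathbb{C}^p$ and $\Delta\subseteq\mathbb{U}_p\times\mathbb{Z}_p$, the finite wavelet system is the family $\mathcal{W}(\mathbf{y},\Delta):=\{T_kD_m\mathbf{y}:(m,k)\in\Delta\}$. A finite family $\{\mathbf{y}_j\}_j$ in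 $\mathbb{C}^p$ is a frame for $\mathbb{C}^p$ if there are constants $0<A\le B<\infty$ with $A\|\mathbf{x}\|_2^2\le\sum_j|\langle\mathbf{x},\mathbf{y}_j\rangle|^2\le B\|\mathbf{x}\|_2^2$ for all $\mathbf{x}\in\mathbb{C}^p$ (equivalently, it spans $\mathbb{C}^p$). For a subgroup $\mathbb{M}$ of $\mathbb{U}_p$ of order $M$, with $a:=\frac{p-1}{M}$, the matrix $\mathbf{Y}(\mathbb{M},\mathbf{y})$ (relative to the fixed generator $\epsilon$) is the $a\times M$ matrix whose entry in row $t\in\{0,\dots,a-1\}$ and column $r\in\{0,\dots,M-1\}$ is $\widehat{\mathbf{y}}(\epsilon^{ra+t})$, with powers of $\epsilon$ taken modulo $p$. A nonzero row is a row with at least one nonzero entry. *)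

theory Defs
  imports
    Complex_Main
    "HOL-Library.FuncSet"
    "HOL-Algebra.Generated_Groups"
    "HOL-Number_Theory.Number_Theory"
    "Jordan_Normal_Form.Matrix"
begin

abbreviation Zp :: "nat \<Rightarrow> int ring" where
  "Zp p \<equiv> residue_ring (int p)"

abbreviation Up :: "nat \<Rightarrow> int monoid" where
  "Up p \<equiv> mult_of (Zp p)"

text \<open>Elements of \<open>\<complex>\<^sup>p\<close> are functions on the residues \<open>0, \<dots>, p - 1\<close>; extensionality makes
  the value outside this set irrelevant, so that equality is equality in \<open>\<complex>\<^sup>p\<close>.\<close>

definition Cp :: "nat \<Rightarrow> (int \<Rightarrow> complex) set" where
  "Cp p = carrier (Zp p) \<rightarrow>\<^sub>E UNIV"

definition inner_Cp :: "nat \<Rightarrow> (int \<Rightarrow> complex) \<Rightarrow> (int \<Rightarrow> complex) \<Rightarrow> complex" where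
  "inner_Cp p x y = (\<Sum>k\<in>carrier (Zp p). x k * cnj (y k))"

definition norm_Cp :: "nat \<Rightarrow> (int \<Rightarrow> complex) \<Rightarrow> real" where
  "norm_Cp p x = sqrt (\<Sum>k\<in>carrier (Zp p). (cmod (x k))\<^sup>2)"

definition norm0 :: "nat \<Rightarrow> (int \<Rightarrow> complex) \<Rightarrow> nat" where
  "norm0 p x = card {k \<in> carrier (Zp p). x k \<noteq> 0}"

definition dft :: "nat \<Rightarrow> (int \<Rightarrow> complex) \<Rightarrow> (int \<Rightarrow> complex)" where
  "dft p x = (\<lambda>l\<in>carrier (Zp p). complex_of_real (1 / sqrt (real p)) *
     (\<Sum>k\<in>carrier (Zp p). x k * exp (- 2 * complex_of_real pi * \<i> * of_int l * of_int k / of_nat p)))"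

definition translation :: "nat \<Rightarrow> int \<Rightarrow> (int \<Rightarrow> complex) \<Rightarrow> (int \<Rightarrow> complex)" where
  "translation p k x = (\<lambda>s\<in>carrier (Zp p). x (s \<ominus>\<^bsub>Zp p\<^esub> k))"

definition dilation :: "nat \<Rightarrow> int \<Rightarrow> (int \<Rightarrow> complex) \<Rightarrow> (int \<Rightarrow> complex)" where
  "dilation p m x = (\<lambda>k\<in>carrier (Zp p). x ((inv\<^bsub>Up p\<^esub> m) \<otimes>\<^bsub>Zp p\<^esub> k))"

text \<open>Frames are families \<open>v\<close> over a finite index set \<open>J\<close>: repeated vectors are counted with
  multiplicity.\<close>

definition is_frame :: "nat \<Rightarrow> 'j set \<Rightarrow> ('j \<Rightarrow> int \<Rightarrow> complex) \<Rightarrow> bool" where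
  "is_frame p J v \<longleftrightarrow> finite J \<and> (\<forall>j\<in>J. v j \<in> Cp p) \<and>
     (\<exists>A B :: real. 0 < A \<and> A \<le> B \<and>
        (\<forall>x\<in>Cp p. A * (norm_Cp p x)\<^sup>2 \<le> (\<Sum>j\<in>J. (cmod (inner_Cp p x (v j)))\<^sup>2) \<and>
                   (\<Sum>j\<in>J. (cmod (inner_Cp p x (v j)))\<^sup>2) \<le> B * (norm_Cp p x)\<^sup>2))"

definition wavelet :: "nat \<Rightarrow> (int \<Rightarrow> complex) \<Rightarrow> int \<times> int \<Rightarrow> (int \<Rightarrow> complex)" where
  "wavelet p y = (\<lambda>(m, k). translation p k (dilation p m y))"

definition wavelet_frame :: "nat \<Rightarrow> (int \<Rightarrow> complex) \<Rightarrow> (int \<times> int) set \<Rightarrow> bool" where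
  "wavelet_frame p y \<Delta> \<longleftrightarrow> is_frame p \<Delta> (wavelet p y)"

definition Ymat :: "nat \<Rightarrow> int \<Rightarrow> int set \<Rightarrow> (int \<Rightarrow> complex) \<Rightarrow> complex mat" where
  "Ymat p \<epsilon> M y = (let a = (p - 1) div card M in
     mat a (card M) (\<lambda>(t, r). dft p y (\<epsilon> [^]\<^bsub>Up p\<^esub> (r * a + t))))"

definition num_nonzero_rows :: "'a::zero mat \<Rightarrow> nat" where
  "num_nonzero_rows A = card {t. t < dim_row A \<and> (\<exists>r<dim_col A. A $$ (t, r) \<noteq> 0)}"

text \<open>The tuples \<open>(r\<^sub>1, \<dots>, r\<^sub>k)\<close> are extensional functions on \<open>{1..k}\<close>. The inequality is
  stated over the integers to avoid truncated subtraction.\<close>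

definition Lambda ::
  "nat \<Rightarrow> int \<Rightarrow> (int \<Rightarrow> complex) \<Rightarrow> nat \<Rightarrow> (nat \<Rightarrow> nat) \<Rightarrow> (nat \<Rightarrow> nat) \<Rightarrow> (nat \<Rightarrow> nat) set" where
  "Lambda p \<epsilon> y k q \<alpha> =
     {r \<in> (\<Pi>\<^sub>E i\<in>{1..k}. {0..\<alpha> i}).
        int (\<Prod>i=1..k. q i ^ r i) \<le> int (norm0 p (dft p y)) - 1 \<and>
        num_nonzero_rows (Ymat p \<epsilon> (generate (Up p) {\<epsilon> [^]\<^bsub>Up p\<^esub> (\<Prod>i=1..k. q i ^ r i)}) y)
          = (\<Prod>i=1..k. q i ^ r i)}"

end

theory Submission
  imports Defs
begin

text \<open>On the Fourier side a translation multiplies by a unimodular character and a dilation by \<open>m\<close>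
  moves the value at \<open>m * l\<close> to \<open>l\<close>. With Plancherel's identity, the energy of \<open>x\<close> against the
  whole system becomes the weighted sum of the \<open>\<bar>dft p x l\<bar>\<^sup>2\<close>, with the weight \<open>p\<close> times the sum
  over \<open>m \<in> M\<close> of \<open>\<bar>dft p y (m * l)\<bar>\<^sup>2\<close> at \<open>l\<close> (\<open>sum_inner_wavelet\<close>). Such a form is
  bounded below exactly when no weight vanishes, that is, when every orbit of \<open>M\<close> on \<open>\<int>\<^sub>p\<close> meets
  the support of \<open>dft p y\<close> (\<open>wavelet_frame_iff\<close>). The orbit of \<open>0\<close> does so by the hypothesis on
  \<open>dft p y 0\<close>; the other orbits are the cosets of \<open>M\<close> in \<open>\<U>\<^sub>p\<close>.

  Since \<open>\<U>\<^sub>p\<close> is cyclic, \<open>M\<close> is generated by \<open>\<epsilon>\<^sup>a\<close> for a divisor \<open>a\<close> of \<open>p - 1\<close>, and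
  row \<open>t\<close> of the matrix lists the values of \<open>dft p y\<close> on the coset of \<open>\<epsilon>\<^sup>t\<close>. So the frame
  condition says that all \<open>a\<close> rows are nonzero; choosing a nonzero entry in each row and adding
  the point \<open>0\<close> then exhibits \<open>a + 1\<close> points of the support, which is the bound on \<open>a\<close> in
  \<open>\<Lambda>\<close> (\<open>frame_iff_nonzero_rows\<close>). As the divisors of \<open>p - 1\<close> are the products of the
  \<open>q\<^sub>i\<close> to the powers \<open>r\<^sub>i \<le> \<alpha>\<^sub>i\<close>, the tuples in \<open>\<Lambda>\<close> describe precisely the subgroups that
  give frames, and each of them is reached with \<open>s = 0\<close>. A general \<open>s\<close> yields a subgroup containing
  the one for \<open>s = 0\<close>, and enlarging \<open>M\<close> only enlarges orbits, so it yields a frame as well.\<close>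

section \<open>Subgroups of finite cyclic groups\<close>

lemma (in group) generate_pow_dvd_ord:
  assumes fin: "finite (carrier G)" and x: "x \<in> carrier G" and a: "a dvd ord x"
  shows "generate G {x [^] a} = {x [^] (a * j) | j. j < ord x div a}"
    and "card (generate G {x [^] a}) = ord x div a"
proof -
  have pos: "ord x > 0" using ord_ge_1[OF fin x] by simp
  then have a0: "a \<noteq> 0" using a by auto
  have ord: "ord (x [^] a) = ord x div a" using ord_pow[OF x a a0] .
  have pos': "ord x div a > 0" using pos a a0 by (auto elim: dvdE)
  have xa: "x [^] a \<in> carrier G" using x by simp
  show "generate G {x [^] a} = {x [^] (a * j) | j. j < ord x div a}"
    unfolding generate_pow_on_finite_carrier[OF fin xa] ord_elems[OF fin xa] ord
    using pos' by (auto simp: nat_pow_pow[OF x] atLeast0AtMost)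
  show "card (generate G {x [^] a}) = ord x div a"
    using generate_pow_card[OF xa] ord by simp
qed

lemma (in group) pow_mult_in_generate:
  assumes "finite (carrier G)" and x: "x \<in> carrier G"
  shows "x [^] (a * j :: nat) \<in> generate G {x [^] a}"
  unfolding generate_pow_on_finite_carrier[OF assms(1) nat_pow_closed[OF x]] nat_pow_pow[OF x]
  by blast

text \<open>Each element of a subgroup of order \<open>c\<close> is killed by \<open>c\<close>. In a cyclic group with
  \<open>a * c\<close> elements this makes its exponent a multiple of \<open>a\<close>, so the subgroup lies in the one
  generated by the \<open>a\<close>-th power of the generator, which has \<open>c\<close> elements as well.\<close>

lemma (in group) subgroup_of_cyclic_group:
  assumes fin: "finite (carrier G)" and x: "x \<in> carrier G"
    and gen: "generate G {x} = carrier G" and H: "subgroup H G"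
  obtains a where "a dvd ord x" "H = generate G {x [^] a}"
proof -
  have ordx: "ord x = order G" using generate_pow_card[OF x] gen by (simp add: order_def)
  have "card (rcosets H) * card H = order G" using lagrange_finite[OF fin H] .
  then obtain a where a: "a * card H = ord x" using ordx by auto
  have pos: "ord x > 0" using ord_ge_1[OF fin x] by simp
  have HG: "H \<subseteq> carrier G" using H by (rule subgroup.subset)
  have finG: "finite (generate G {x [^] a})"
    using generate_incl[of "{x [^] a}"] x fin finite_subset by auto
  have "H \<subseteq> generate G {x [^] a}"
  proof
    fix h assume h: "h \<in> H"
    then have hG: "h \<in> carrier G" using HG by auto
    then obtain n :: nat where n: "h = x [^] n"
      using gen generate_pow_on_finite_carrier[OF fin x] by auto
    have "h [^] card H = \<one>"
    proof -
      interpret S: group "G\<lparr>carrier := H\<rparr>" using H subgroup_imp_group by blast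
      have "h [^]\<^bsub>G\<lparr>carrier := H\<rparr>\<^esub> order (G\<lparr>carrier := H\<rparr>) = \<one>\<^bsub>G\<lparr>carrier := H\<rparr>\<^esub>"
        using S.pow_order_eq_1[of h] h by simp
      then show ?thesis by (simp add: order_def nat_pow_consistent[symmetric])
    qed
    then have "x [^] (n * card H) = \<one>" using n x by (simp add: nat_pow_pow)
    then have "a * card H dvd n * card H" using pow_eq_id[OF x] a by simp
    moreover have "card H \<noteq> 0" using pos a by (metis mult_0_right less_not_refl)
    ultimately have "a dvd n" by simp
    then obtain j where "n = a * j" by auto
    then show "h \<in> generate G {x [^] a}" using n pow_mult_in_generate[OF fin x] by simp
  qed
  moreover have "card H = card (generate G {x [^] a})"
    using generate_pow_dvd_ord(2)[OF fin x, of a] a pos by (metis dvd_triv_left nonzero_mult_div_cancel_left mult_is_0 less_not_refl)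
  ultimately have "H = generate G {x [^] a}" using card_subset_eq[OF finG] by auto
  then show thesis using that a by (metis dvd_triv_left)
qed

section \<open>Residues modulo a prime\<close>

lemma carrier_Zp: "carrier (Zp p) = {0..int p - 1}"
  by (simp add: residue_ring_def)

lemma mult_Zp: "x \<otimes>\<^bsub>Zp p\<^esub> y = x * y mod int p"
  by (simp add: residue_ring_def)

lemma one_Zp: "\<one>\<^bsub>Zp p\<^esub> = 1" and zero_Zp: "\<zero>\<^bsub>Zp p\<^esub> = 0"
  by (simp_all add: residue_ring_def)

lemma carrier_Up: "carrier (Up p) = {1..int p - 1}"
  unfolding carrier_mult_of carrier_Zp zero_Zp by auto

lemma card_Up: "card (carrier (Up p)) = p - 1"
  unfolding carrier_Up by simp

lemma finite_Zp [simp]: "finite (carrier (Zp p))"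
  by (simp add: carrier_Zp)

lemma a_minus_Zp:
  assumes "1 < p"
  shows "x \<ominus>\<^bsub>Zp p\<^esub> y = (x - y) mod int p"
proof -
  interpret residues "int p" "Zp p" using assms by unfold_locales auto
  show ?thesis 
    by (simp add: a_minus_def res_neg_eq res_add_eq mod_add_right_eq)
qed

lemma mod_in_Zp: "p > 0 \<Longrightarrow> j mod int p \<in> carrier (Zp p)"
  by (simp add: carrier_Zp)

lemma mod_Zp [simp]: "j \<in> carrier (Zp p) \<Longrightarrow> j mod int p = j"
  by (simp add: carrier_Zp)

lemma group_Up: "prime p \<Longrightarrow> group (Up p)"
proof -
  assume "prime p"
  then interpret residues_prime p "Zp p" by unfold_locales auto
  interpret field "Zp p" by (rule is_field)
  show ?thesis by (rule field_mult_group)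
qed

section \<open>The discrete Fourier transform\<close>

text \<open>Taking \<open>j\<close> in \<open>\<int>\<close> rather than among the representatives \<open>0, \<dots>, p - 1\<close> lets
  frequencies and differences of indices be combined with integer arithmetic, free of reductions
  modulo \<open>p\<close>.\<close>

definition character :: "nat \<Rightarrow> int \<Rightarrow> complex" where
  "character p j = cis (2 * pi * of_int j / of_nat p)"

lemma character_add: "character p (i + j) = character p i * character p j"
  by (simp add: character_def cis_mult ring_distribs add_divide_distrib)

lemma cnj_character: "cnj (character p j) = character p (- j)"
  by (simp add: character_def cis_cnj)

lemma cmod_character [simp]: "cmod (character p j) = 1"
  by (simp add: character_def)

lemma mult_character_cnj:
  "(u * character p i) * cnj (v * character p j) = u * cnj v * character p (i - j)"
  using character_add[of p i "- j"] by (simp add: cnj_character)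

lemma character_eq_1_iff:
  assumes "p > 0" shows "character p j = 1 \<longleftrightarrow> int p dvd j"
proof -
  have "character p j = 1 \<longleftrightarrow> (\<exists>n::int. 2 * pi * j / p = n * (2 * pi))"
    unfolding character_def complex_eq_iff cis.sel one_complex.sel
    by (metis cos_one_2pi_int cos_one_sin_zero mult.assoc times_divide_eq_right)
  also have "\<dots> \<longleftrightarrow> (\<exists>n::int. real_of_int j = real_of_int (int p * n))"
    using assms by (auto simp: field_simps)
  also have "\<dots> \<longleftrightarrow> int p dvd j" by (simp only: of_int_eq_iff dvd_def)
  finally show ?thesis .
qed

lemma character_cong:
  assumes "p > 0" "[i = j] (mod int p)" shows "character p i = character p j"
proof -
  have "character p (i - j) = 1" using assms by (simp add: character_eq_1_iff cong_iff_dvd_diff)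
  then show ?thesis using character_add[of p "i - j" j] by simp
qed

text \<open>If \<open>p\<close> does not divide \<open>j\<close>, shifting the summation index by \<open>1\<close> permutes the residues and
  multiplies the sum by \<open>character p j \<noteq> 1\<close>, so the sum vanishes.\<close>

lemma sum_character:
  assumes "p > 0"
  shows "(\<Sum>k\<in>carrier (Zp p). character p (j * k)) = (if int p dvd j then of_nat p else 0)"
proof (cases "int p dvd j")
  case True
  then have "character p (j * k) = 1" for k using assms by (simp add: character_eq_1_iff)
  then show ?thesis using True by (simp add: carrier_Zp)
next
  case False
  let ?S = "\<Sum>k\<in>carrier (Zp p). character p (j * k)"
  have "character p j * ?S = (\<Sum>k\<in>carrier (Zp p). character p (j * (k + 1)))"
    by (simp add: sum_distrib_left distrib_left character_add mult.commute)
  also have "\<dots> = ?S"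
  proof (rule sum.reindex_bij_witness[where j = "\<lambda>k. (k + 1) mod int p" and i = "\<lambda>k. (k - 1) mod int p"])
    fix k
    show "character p (j * ((k + 1) mod int p)) = character p (j * (k + 1))"
      using assms by (rule character_cong) (simp add: cong_def mod_mult_right_eq)
  qed (use assms in \<open>simp_all add: mod_in_Zp mod_simps\<close>)
  finally have "(character p j - 1) * ?S = 0" by (simp add: algebra_simps)
  then show ?thesis using False assms by (simp add: character_eq_1_iff)
qed

lemma dft_eq:
  assumes "l \<in> carrier (Zp p)"
  shows "dft p x l = (\<Sum>k\<in>carrier (Zp p). x k * character p (- (l * k))) / sqrt p"
proof -
  have "exp (- 2 * complex_of_real pi * \<i> * of_int l * of_int k / of_nat p) = character p (- (l * k))" for k
    by (simp add: character_def cis_conv_exp algebra_simps)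
  then show ?thesis using assms by (simp add: dft_def)
qed

text \<open>Expanding the squares gives a triple sum in which orthogonality of the characters, applied to
  the sum over the frequency \<open>l\<close>, keeps only the diagonal terms.\<close>

lemma plancherel:
  assumes "p > 0"
  shows "(\<Sum>l\<in>carrier (Zp p). (cmod (dft p x l))\<^sup>2) = (norm_Cp p x)\<^sup>2"
proof -
  let ?Z = "carrier (Zp p)"
  let ?e = "character p"
  have "complex_of_real (\<Sum>l\<in>?Z. (cmod (dft p x l))\<^sup>2) = (\<Sum>l\<in>?Z. dft p x l * cnj (dft p x l))"
    by (simp add: complex_norm_square[symmetric])
  also have "\<dots> = (\<Sum>l\<in>?Z. (\<Sum>j\<in>?Z. \<Sum>k\<in>?Z. x j * cnj (x k) * ?e ((k - j) * l)) / p)"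
  proof (rule sum.cong[OF refl])
    fix l assume l: "l \<in> ?Z"
    have "complex_of_real (sqrt p) * complex_of_real (sqrt p) = p"
      by (metis of_nat_0_le_iff of_real_mult of_real_of_nat_eq real_sqrt_mult_self abs_of_nat)
    then have "dft p x l * cnj (dft p x l)
        = (\<Sum>j\<in>?Z. x j * ?e (- (l * j))) * cnj (\<Sum>k\<in>?Z. x k * ?e (- (l * k))) / p"
      by (simp add: dft_eq[OF l] del: cnj_sum)
    moreover have "- (l * j) - - (l * k) = (k - j) * l" for j k by (simp add: algebra_simps)
    ultimately show "dft p x l * cnj (dft p x l) = (\<Sum>j\<in>?Z. \<Sum>k\<in>?Z. x j * cnj (x k) * ?e ((k - j) * l)) / p"
      by (simp only: cnj_sum sum_product mult_character_cnj)
  qed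
  also have "\<dots> = (\<Sum>j\<in>?Z. \<Sum>k\<in>?Z. x j * cnj (x k) * (\<Sum>l\<in>?Z. ?e ((k - j) * l))) / p"
    unfolding sum_divide_distrib[symmetric] sum_distrib_left
    by (rule arg_cong2[where f = "(/)", OF trans[OF sum.swap sum.cong[OF refl sum.swap]] refl])
  also have "\<dots> = (\<Sum>j\<in>?Z. \<Sum>k\<in>?Z. if k = j then x j * cnj (x j) * p else 0) / p"
  proof -
    have "x j * cnj (x k) * (\<Sum>l\<in>?Z. ?e ((k - j) * l)) = (if k = j then x j * cnj (x j) * p else 0)"
      if "j \<in> ?Z" "k \<in> ?Z" for j k
    proof -
      have "int p dvd k - j \<longleftrightarrow> k = j"
        using that by (metis mod_Zp mod_eq_dvd_iff)
      then show ?thesis using sum_character[OF assms, of "k - j"] by simp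
    qed
    then show ?thesis by simp
  qed
  also have "\<dots> = (\<Sum>j\<in>?Z. x j * cnj (x j))"
    using assms by (simp add: sum_divide_distrib)
  also have "\<dots> = complex_of_real ((norm_Cp p x)\<^sup>2)"
    by (simp add: norm_Cp_def sum_nonneg complex_norm_square[symmetric])
  finally show ?thesis using of_real_eq_iff by blast
qed

text \<open>As a function of \<open>k\<close>, the inner products with the translates form the convolution of \<open>x\<close> with
  the reflected conjugate of \<open>z\<close>. Its transform is the product of the transform of \<open>x\<close> and the
  conjugate transform of \<open>z\<close>, up to the factor \<open>sqrt p\<close> of the unitary normalization, and Plancherel's
  identity applies to it.\<close>

lemma sum_inner_translation:
  assumes "1 < p"
  shows "(\<Sum>k\<in>carrier (Zp p). (cmod (inner_Cp p x (translation p k z)))\<^sup>2)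
       = p * (\<Sum>l\<in>carrier (Zp p). (cmod (dft p x l))\<^sup>2 * (cmod (dft p z l))\<^sup>2)"
proof -
  let ?Z = "carrier (Zp p)"
  let ?e = "character p"
  define c where "c k = inner_Cp p x (translation p k z)" for k
  have p0: "p > 0" using assms by simp
  have sq: "complex_of_real (sqrt p) * complex_of_real (sqrt p) = p"
    by (metis of_nat_0_le_iff of_real_mult of_real_of_nat_eq real_sqrt_mult_self abs_of_nat)
  have sq0: "complex_of_real (sqrt p) \<noteq> 0" using p0 by simp
  have c: "c k = (\<Sum>s\<in>?Z. x s * cnj (z ((s - k) mod int p)))" for k
    by (simp add: c_def inner_Cp_def translation_def a_minus_Zp[OF assms])
  have dft_c: "dft p c l = sqrt p * dft p x l * cnj (dft p z l)" if l: "l \<in> ?Z" for l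
  proof -
    have "(\<Sum>k\<in>?Z. c k * ?e (- (l * k)))
        = (\<Sum>s\<in>?Z. x s * (\<Sum>k\<in>?Z. cnj (z ((s - k) mod int p)) * ?e (- (l * k))))"
      unfolding c sum_distrib_right sum_distrib_left by (subst sum.swap) (simp add: mult.assoc)
    also have "\<dots> = (\<Sum>s\<in>?Z. x s * (\<Sum>u\<in>?Z. cnj (z u) * ?e (- (l * (s - u)))))"
    proof (rule sum.cong[OF refl], rule arg_cong2[where f = "(*)", OF refl])
      fix s
      show "(\<Sum>k\<in>?Z. cnj (z ((s - k) mod int p)) * ?e (- (l * k)))
          = (\<Sum>u\<in>?Z. cnj (z u) * ?e (- (l * (s - u))))"
      proof (rule sum.reindex_bij_witness[where j = "\<lambda>k. (s - k) mod int p" and i = "\<lambda>k. (s - k) mod int p"])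
        fix k
        have "[s - (s - k) mod int p = s - (s - k)] (mod int p)"
          by (simp add: cong_def mod_simps)
        then have "[- (l * (s - (s - k) mod int p)) = - (l * (s - (s - k)))] (mod int p)"
          unfolding cong_minus_minus_iff by (rule cong_scalar_left)
        then show "cnj (z ((s - k) mod int p)) * ?e (- (l * (s - (s - k) mod int p)))
            = cnj (z ((s - k) mod int p)) * ?e (- (l * k))"
          using character_cong[OF p0] by simp
      qed (use p0 in \<open>simp_all add: mod_in_Zp mod_simps\<close>)
    qed
    also have "\<dots> = (\<Sum>s\<in>?Z. x s * ?e (- (l * s))) * cnj (\<Sum>u\<in>?Z. z u * ?e (- (l * u)))"
    proof -
      have "- (l * s) - - (l * u) = - (l * (s - u))" for s u by (simp add: algebra_simps)
      then show ?thesis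
        unfolding cnj_sum sum_product mult_character_cnj by (simp only: sum_distrib_left mult.assoc)
    qed
    finally show ?thesis using sq sq0 by (simp add: dft_eq[OF l] field_simps)
  qed
  have "(\<Sum>k\<in>?Z. (cmod (c k))\<^sup>2) = (norm_Cp p c)\<^sup>2"
    by (simp add: norm_Cp_def sum_nonneg)
  also have "\<dots> = (\<Sum>l\<in>?Z. (cmod (dft p c l))\<^sup>2)" using plancherel[OF p0] by simp
  also have "\<dots> = p * (\<Sum>l\<in>?Z. (cmod (dft p x l))\<^sup>2 * (cmod (dft p z l))\<^sup>2)"
    by (simp add: dft_c norm_mult power_mult_distrib sum_distrib_left mult.assoc)
  finally show ?thesis by (simp add: c_def)
qed

text \<open>Replacing \<open>k\<close> by \<open>m * k\<close> cancels the inverse of \<open>m\<close> in the argument of \<open>y\<close> and moves \<open>m\<close> to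
  the frequency.\<close>

lemma dft_dilation:
  assumes p: "prime p" and m: "m \<in> carrier (Up p)" and l: "l \<in> carrier (Zp p)"
  shows "dft p (dilation p m y) l = dft p y (m \<otimes>\<^bsub>Zp p\<^esub> l)"
proof -
  let ?Z = "carrier (Zp p)"
  interpret U: group "Up p" using group_Up[OF p] .
  define n where "n = inv\<^bsub>Up p\<^esub> m"
  have p0: "p > 0" "p > 1" using p prime_gt_1_nat by (auto simp: prime_gt_0_nat)
  have "m \<otimes>\<^bsub>Up p\<^esub> n = \<one>\<^bsub>Up p\<^esub>" unfolding n_def using m by (rule U.r_inv)
  then have "m * n mod int p = 1" by (simp only: mult_mult_of one_mult_of mult_Zp one_Zp)
  then have mn: "[m * n = 1] (mod int p)" using p0 by (simp add: cong_def)
  have inv1: "m * (n * k mod int p) mod int p = k" if "k \<in> ?Z" for k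
    using cong_scalar_right[OF mn, of k] that by (simp add: cong_def mod_simps mult.assoc)
  have inv2: "n * (m * k mod int p) mod int p = k" if "k \<in> ?Z" for k
    using cong_scalar_right[OF mn, of k] that by (simp add: cong_def mod_simps ac_simps)
  have ml: "m \<otimes>\<^bsub>Zp p\<^esub> l \<in> ?Z" using p0 by (simp add: mult_Zp mod_in_Zp)
  have "(\<Sum>k\<in>?Z. dilation p m y k * character p (- (l * k)))
      = (\<Sum>k\<in>?Z. y (n * k mod int p) * character p (- (l * k)))"
    by (simp add: dilation_def n_def mult_Zp)
  also have "\<dots> = (\<Sum>k\<in>?Z. y k * character p (- ((m * l mod int p) * k)))"
  proof (rule sum.reindex_bij_witness[where j = "\<lambda>k. n * k mod int p" and i = "\<lambda>k. m * k mod int p"])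
    fix k assume k: "k \<in> ?Z"
    have "[(m * l mod int p) * (n * k mod int p) = (m * l) * (n * k)] (mod int p)"
      unfolding cong_def by (rule mod_mult_eq)
    also have "(m * l) * (n * k) = m * n * (l * k)" by (simp only: ac_simps)
    also have "[m * n * (l * k) = 1 * (l * k)] (mod int p)" using mn by (rule cong_scalar_right)
    finally show "y (n * k mod int p) * character p (- ((m * l mod int p) * (n * k mod int p)))
        = y (n * k mod int p) * character p (- (l * k))"
      using p0 by (auto intro!: character_cong simp: cong_minus_minus_iff)
  qed (use p0 in \<open>auto simp: mod_in_Zp inv1 inv2\<close>)
  finally show ?thesis using ml by (simp add: dft_eq l mult_Zp)
qed

section \<open>Wavelet frames\<close>

text \<open>Characters have a transform concentrated at one frequency; they are the test vectors that
  detect a vanishing weight in the energy of the wavelet system.\<close>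

lemma dft_character:
  assumes "p > 0" "l \<in> carrier (Zp p)" "n \<in> carrier (Zp p)"
  shows "dft p (\<lambda>k\<in>carrier (Zp p). character p (n * k)) l = (if l = n then complex_of_real (sqrt p) else 0)"
proof -
  have "int p dvd n - l \<longleftrightarrow> l = n"
    using assms by (metis mod_Zp mod_eq_dvd_iff)
  then have "(\<Sum>k\<in>carrier (Zp p). character p (n * k) * character p (- (l * k)))
           = (if l = n then of_nat p else 0)"
    using sum_character[OF assms(1), of "n - l"] 
      mult_character_cnj[of 1 p "n * k" 1 "l * k" for k] by (simp add: left_diff_distrib cnj_character)
  moreover have "complex_of_nat p / complex_of_real (sqrt p) = complex_of_real (sqrt p)"
    by (metis of_real_divide of_real_of_nat_eq real_div_sqrt of_nat_0_le_iff)
  ultimately show ?thesis by (simp add: dft_eq[OF assms(2)])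
qed

text \<open>The frame operator is diagonal in the Fourier basis.\<close>

lemma sum_inner_wavelet:
  assumes p: "prime p" and M: "M \<subseteq> carrier (Up p)"
  shows "(\<Sum>j\<in>M \<times> carrier (Zp p). (cmod (inner_Cp p x (wavelet p y j)))\<^sup>2)
    = p * (\<Sum>l\<in>carrier (Zp p). (\<Sum>m\<in>M. (cmod (dft p y (m \<otimes>\<^bsub>Zp p\<^esub> l)))\<^sup>2) * (cmod (dft p x l))\<^sup>2)"
proof -
  let ?Z = "carrier (Zp p)"
  have p1: "p > 1" using p prime_gt_1_nat by auto
  have "(\<Sum>j\<in>M \<times> ?Z. (cmod (inner_Cp p x (wavelet p y j)))\<^sup>2)
      = (\<Sum>m\<in>M. \<Sum>k\<in>?Z. (cmod (inner_Cp p x (translation p k (dilation p m y))))\<^sup>2)"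
    by (simp add: sum.cartesian_product wavelet_def split_def)
  also have "\<dots> = (\<Sum>m\<in>M. p * (\<Sum>l\<in>?Z. (cmod (dft p x l))\<^sup>2 * (cmod (dft p y (m \<otimes>\<^bsub>Zp p\<^esub> l)))\<^sup>2))"
  proof (rule sum.cong[OF refl])
    fix m assume "m \<in> M"
    then have m: "m \<in> carrier (Up p)" using M by (rule rev_subsetD)
    show "(\<Sum>k\<in>?Z. (cmod (inner_Cp p x (translation p k (dilation p m y))))\<^sup>2)
        = p * (\<Sum>l\<in>?Z. (cmod (dft p x l))\<^sup>2 * (cmod (dft p y (m \<otimes>\<^bsub>Zp p\<^esub> l)))\<^sup>2)"
      unfolding sum_inner_translation[OF p1] using dft_dilation[OF p m] by simp
  qed
  also have "\<dots> = p * (\<Sum>l\<in>?Z. (\<Sum>m\<in>M. (cmod (dft p y (m \<otimes>\<^bsub>Zp p\<^esub> l)))\<^sup>2) * (cmod (dft p x l))\<^sup>2)"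
    unfolding sum_distrib_left[symmetric] sum_distrib_right
    by (subst sum.swap) (simp only: mult.commute)
  finally show ?thesis .
qed

text \<open>The optimal frame bounds are \<open>p\<close> times the least and the greatest of the weights \<open>S l\<close>. If some
  \<open>S n\<close> vanishes, the character of frequency \<open>n\<close> is orthogonal to the whole system.\<close>

lemma wavelet_frame_iff:
  assumes p: "prime p" and M: "M \<subseteq> carrier (Up p)"
  shows "wavelet_frame p y (M \<times> carrier (Zp p)) \<longleftrightarrow>
         (\<forall>l\<in>carrier (Zp p). \<exists>m\<in>M. dft p y (m \<otimes>\<^bsub>Zp p\<^esub> l) \<noteq> 0)"
proof -
  let ?Z = "carrier (Zp p)"
  define S where "S l = (\<Sum>m\<in>M. (cmod (dft p y (m \<otimes>\<^bsub>Zp p\<^esub> l)))\<^sup>2)" for l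
  have p0: "p > 0" using p prime_gt_0_nat by auto
  have finM: "finite M" using finite_subset[OF M] by simp
  have S_nonneg: "S l \<ge> 0" for l by (simp add: S_def sum_nonneg)
  have S_pos_iff: "S l > 0 \<longleftrightarrow> (\<exists>m\<in>M. dft p y (m \<otimes>\<^bsub>Zp p\<^esub> l) \<noteq> 0)" for l
  proof -
    have "S l = 0 \<longleftrightarrow> (\<forall>m\<in>M. dft p y (m \<otimes>\<^bsub>Zp p\<^esub> l) = 0)"
      unfolding S_def using finM by (subst sum_nonneg_eq_0_iff) auto
    then show ?thesis using S_nonneg[of l] by (auto simp: less_le)
  qed
  have energy: "(\<Sum>j\<in>M \<times> ?Z. (cmod (inner_Cp p x (wavelet p y j)))\<^sup>2)
      = p * (\<Sum>l\<in>?Z. S l * (cmod (dft p x l))\<^sup>2)" for x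
    using sum_inner_wavelet[OF p M] by (simp add: S_def)
  have in_Cp: "\<forall>j\<in>M \<times> ?Z. wavelet p y j \<in> Cp p"
    by (auto simp: wavelet_def translation_def Cp_def)
  show ?thesis
  proof
    assume "wavelet_frame p y (M \<times> ?Z)"
    then obtain A where A: "A > 0" and
      lower: "\<forall>x\<in>Cp p. A * (norm_Cp p x)\<^sup>2 \<le> p * (\<Sum>l\<in>?Z. S l * (cmod (dft p x l))\<^sup>2)"
      unfolding wavelet_frame_def is_frame_def energy by blast
    show "\<forall>l\<in>?Z. \<exists>m\<in>M. dft p y (m \<otimes>\<^bsub>Zp p\<^esub> l) \<noteq> 0"
    proof
      fix n assume n: "n \<in> ?Z"
      let ?x = "\<lambda>k\<in>?Z. character p (n * k)"
      have x: "?x \<in> Cp p" by (simp add: Cp_def)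
      have "(norm_Cp p ?x)\<^sup>2 = p" by (simp add: norm_Cp_def) (simp add: carrier_Zp)
      moreover have "(\<Sum>l\<in>?Z. S l * (cmod (dft p ?x l))\<^sup>2) = (\<Sum>l\<in>?Z. if l = n then S n * p else 0)"
        using n p0 by (intro sum.cong refl) (auto simp: dft_character)
      ultimately have "A * p \<le> p * (S n * p)" using bspec[OF lower x] n by simp
      moreover have "0 < A * p" using A p0 by simp
      ultimately have "0 < p * (S n * p)" by linarith
      then have "S n > 0" using p0 by (simp add: zero_less_mult_iff)
      then show "\<exists>m\<in>M. dft p y (m \<otimes>\<^bsub>Zp p\<^esub> n) \<noteq> 0" using S_pos_iff by simp
    qed
  next
    assume R: "\<forall>l\<in>?Z. \<exists>m\<in>M. dft p y (m \<otimes>\<^bsub>Zp p\<^esub> l) \<noteq> 0"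
    have ne: "S ` ?Z \<noteq> {}" using p0 by (auto simp: carrier_Zp)
    define A where "A = Min (S ` ?Z)"
    define B where "B = Max (S ` ?Z)"
    have A: "A > 0" unfolding A_def using R S_pos_iff ne by simp
    have AS: "A \<le> S l" and SB: "S l \<le> B" if "l \<in> ?Z" for l
      unfolding A_def B_def using that by auto
    have AB: "A \<le> B" unfolding A_def B_def using ne by (meson Max_ge Min_in finite_Zp finite_imageI)
    have "A * (norm_Cp p x)\<^sup>2 \<le> (\<Sum>l\<in>?Z. S l * (cmod (dft p x l))\<^sup>2)"
      and "(\<Sum>l\<in>?Z. S l * (cmod (dft p x l))\<^sup>2) \<le> B * (norm_Cp p x)\<^sup>2" for x
      unfolding plancherel[OF p0, symmetric] sum_distrib_left
      by (auto intro!: sum_mono mult_right_mono AS SB)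
    then have "p * A * (norm_Cp p x)\<^sup>2 \<le> p * (\<Sum>l\<in>?Z. S l * (cmod (dft p x l))\<^sup>2) \<and>
        p * (\<Sum>l\<in>?Z. S l * (cmod (dft p x l))\<^sup>2) \<le> p * B * (norm_Cp p x)\<^sup>2" for x
      unfolding mult.assoc using p0 by simp
    then show "wavelet_frame p y (M \<times> ?Z)"
      unfolding wavelet_frame_def is_frame_def energy
      using in_Cp finM A AB p0
      by (intro conjI exI[of _ "p * A"] exI[of _ "p * B"]) auto
  qed
qed

lemma num_nonzero_rows_eq_dim_row_iff:
  "num_nonzero_rows A = dim_row A \<longleftrightarrow> (\<forall>t<dim_row A. \<exists>r<dim_col A. A $$ (t, r) \<noteq> 0)"
proof -
  have "card {t \<in> {..<n}. P t} = n \<longleftrightarrow> (\<forall>t<n. P t)" for n :: nat and P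
  proof
    assume "card {t \<in> {..<n}. P t} = n"
    then have "{t \<in> {..<n}. P t} = {..<n}" by (intro card_subset_eq) auto
    then show "\<forall>t<n. P t" by blast
  next
    assume "\<forall>t<n. P t"
    then have "{t \<in> {..<n}. P t} = {..<n}" by auto
    then show "card {t \<in> {..<n}. P t} = n" by simp
  qed
  then show ?thesis by (simp add: num_nonzero_rows_def)
qed

text \<open>Row \<open>t\<close> runs through the values of \<open>dft p y\<close> on the coset of \<open>\<epsilon>\<^sup>t\<close>. For the second claim,
  nonzero entries picked in different rows sit at different frequencies, all of them nonzero, because
  the exponents \<open>r * a + t\<close> lie below the order of \<open>\<epsilon>\<close> and have different residues \<open>t\<close>
  modulo \<open>a\<close>; the frequency \<open>0\<close> is one more point of the support.\<close>

lemma frame_iff_nonzero_rows: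
  assumes p: "prime p" and \<epsilon>: "\<epsilon> \<in> carrier (Up p)" and gen: "generate (Up p) {\<epsilon>} = carrier (Up p)"
    and y0: "dft p y 0 \<noteq> 0" and a: "a dvd p - 1"
  defines "M \<equiv> generate (Up p) {\<epsilon> [^]\<^bsub>Up p\<^esub> a}"
  shows "wavelet_frame p y (M \<times> carrier (Zp p)) \<longleftrightarrow> num_nonzero_rows (Ymat p \<epsilon> M y) = a"
    and "num_nonzero_rows (Ymat p \<epsilon> M y) = a \<Longrightarrow> int a \<le> int (norm0 p (dft p y)) - 1"
proof -
  interpret U: group "Up p" using group_Up[OF p] .
  let ?pow = "\<lambda>n::nat. \<epsilon> [^]\<^bsub>Up p\<^esub> n"
  have p1: "p > 1" using p prime_gt_1_nat by auto
  have fin: "finite (carrier (Up p))" by simp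
  have ord: "U.ord \<epsilon> = p - 1"
    unfolding U.generate_pow_card[OF \<epsilon>] gen by (rule card_Up)
  have a': "a dvd U.ord \<epsilon>" using a ord by simp
  define c where "c = (p - 1) div a"
  have ac: "a * c = p - 1" using a by (simp add: c_def)
  have a0: "a > 0" and c0: "c > 0"
  proof -
    have "a * c > 0" unfolding ac using p1 by simp
    then show "a > 0" "c > 0" by simp_all
  qed
  have M: "M = {?pow (a * j) | j. j < c}" and cM: "card M = c"
    using U.generate_pow_dvd_ord[OF fin \<epsilon> a'] ord by (auto simp: M_def c_def)
  have M_mem: "?pow (a * j) \<in> M" for j
    unfolding M_def using U.pow_mult_in_generate[OF fin \<epsilon>] .
  have div: "(p - 1) div c = a" using ac c0 by (metis nonzero_mult_div_cancel_right less_not_refl)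
  have rows: "num_nonzero_rows (Ymat p \<epsilon> M y) = a \<longleftrightarrow> (\<forall>t<a. \<exists>r<c. dft p y (?pow (r * a + t)) \<noteq> 0)"
    using num_nonzero_rows_eq_dim_row_iff[of "mat a c (\<lambda>(t, r). dft p y (?pow (r * a + t)))"]
    unfolding Ymat_def Let_def cM div by (simp cong: conj_cong)
  have powZ: "?pow n \<in> carrier (Zp p)" "?pow n \<noteq> 0" for n
    using U.nat_pow_closed[OF \<epsilon>, of n] unfolding carrier_mult_of zero_Zp by auto
  have mult: "?pow i \<otimes>\<^bsub>Zp p\<^esub> ?pow j = ?pow (i + j)" for i j
    using U.nat_pow_mult[OF \<epsilon>, of i j] by simp
  have MU: "M \<subseteq> carrier (Up p)" using M \<epsilon> U.nat_pow_closed by blast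
  have frame: "wavelet_frame p y (M \<times> carrier (Zp p)) \<longleftrightarrow>
         (\<forall>l\<in>carrier (Zp p). \<exists>m\<in>M. dft p y (m \<otimes>\<^bsub>Zp p\<^esub> l) \<noteq> 0)"
    using wavelet_frame_iff[OF p MU] .
  show "wavelet_frame p y (M \<times> carrier (Zp p)) \<longleftrightarrow> num_nonzero_rows (Ymat p \<epsilon> M y) = a"
    unfolding frame rows
  proof (intro iffI allI impI ballI)
    fix t assume "\<forall>l\<in>carrier (Zp p). \<exists>m\<in>M. dft p y (m \<otimes>\<^bsub>Zp p\<^esub> l) \<noteq> 0"
    then obtain m where "m \<in> M" "dft p y (m \<otimes>\<^bsub>Zp p\<^esub> ?pow t) \<noteq> 0" using powZ by blast
    then obtain j where "j < c" "dft p y (?pow (a * j + t)) \<noteq> 0" unfolding M using mult by auto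
    then show "\<exists>r<c. dft p y (?pow (r * a + t)) \<noteq> 0" by (auto simp: mult.commute)
  next
    fix l assume rows: "\<forall>t<a. \<exists>r<c. dft p y (?pow (r * a + t)) \<noteq> 0" and l: "l \<in> carrier (Zp p)"
    show "\<exists>m\<in>M. dft p y (m \<otimes>\<^bsub>Zp p\<^esub> l) \<noteq> 0"
    proof (cases "l = 0")
      case True
      then show ?thesis using M_mem[of 0] y0 by (intro bexI[of _ "?pow (a * 0)"]) (simp_all add: mult_Zp)
    next
      case False
      then have "l \<in> carrier (Up p)" using l unfolding carrier_mult_of zero_Zp by simp
      then obtain n :: nat where n: "l = ?pow n"
        using gen U.generate_pow_on_finite_carrier[OF fin \<epsilon>] by auto
      have "n mod a < a" using a0 by simp
      then obtain r where r: "r < c" "dft p y (?pow (r * a + n mod a)) \<noteq> 0" using rows by blast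
      define d where "d = n div a"
      have nd: "n = a * d + n mod a" by (simp add: d_def)
      (* With n = a * d + n mod a, the element of M sought is the (r - d)-th power of the generator;
         the nonnegative exponent r + d * (c - 1) is congruent to r - d modulo c, the order of M. *)
      obtain c' where c': "c = Suc c'" using c0 gr0_conv_Suc by blast
      have "a * (r + d * c') + a * d = a * c * d + r * a" unfolding c' by (simp add: algebra_simps)
      then have "a * (r + d * c') + n = (p - 1) * d + (r * a + n mod a)"
        unfolding ac using nd by linarith
      then have "?pow (a * (r + d * c')) \<otimes>\<^bsub>Zp p\<^esub> l = ?pow ((p - 1) * d + (r * a + n mod a))"
        unfolding n mult by simp
      also have "\<dots> = ?pow ((p - 1) * d) \<otimes>\<^bsub>Up p\<^esub> ?pow (r * a + n mod a)"
        using U.nat_pow_mult[OF \<epsilon>] by simp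
      also have "?pow ((p - 1) * d) = \<one>\<^bsub>Up p\<^esub>" using U.pow_eq_id[OF \<epsilon>] ord by simp
      finally have "?pow (a * (r + d * c')) \<otimes>\<^bsub>Zp p\<^esub> l = ?pow (r * a + n mod a)"
        using U.l_one[OF U.nat_pow_closed[OF \<epsilon>]] by simp
      then show ?thesis using M_mem r by (metis (no_types))
    qed
  qed
  assume "num_nonzero_rows (Ymat p \<epsilon> M y) = a"
  then obtain r where r: "r t < c" "dft p y (?pow (r t * a + t)) \<noteq> 0" if "t < a" for t
    unfolding rows by metis
  let ?f = "\<lambda>t. ?pow (r t * a + t)"
  have lt: "r t * a + t < U.ord \<epsilon>" if "t < a" for t
  proof -
    have "r t * a + t < (r t + 1) * a" using that by simp
    also have "\<dots> \<le> c * a" using r(1)[OF that] by (intro mult_right_mono) auto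
    finally show ?thesis using ac ord by (simp add: mult.commute)
  qed
  have inj: "inj_on ?f {..<a}"
  proof (rule inj_onI)
    fix s t assume st: "s \<in> {..<a}" "t \<in> {..<a}" "?f s = ?f t"
    then have "r s * a + s = r t * a + t"
      using inj_onD[OF U.ord_inj[OF \<epsilon>], of "r s * a + s" "r t * a + t"] lt[of s] lt[of t] by auto
    then have "(r s * a + s) mod a = (r t * a + t) mod a" by simp
    then show "s = t" using st by simp
  qed
  have "insert 0 (?f ` {..<a}) \<subseteq> {k \<in> carrier (Zp p). dft p y k \<noteq> 0}"
    using r powZ y0 p1 by (auto simp: carrier_Zp)
  then have "card (insert 0 (?f ` {..<a})) \<le> norm0 p (dft p y)"
    unfolding norm0_def by (intro card_mono) auto
  moreover have "0 \<notin> ?f ` {..<a}" using powZ by force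
  ultimately have "Suc a \<le> norm0 p (dft p y)" using card_image[OF inj] by simp
  then show "int a \<le> int (norm0 p (dft p y)) - 1" by simp
qed

section \<open>Divisors and exponent vectors\<close>

text \<open>A divisor of a product factors accordingly, so induction over the index set reduces the claim
  to divisors of one prime power.\<close>

lemma dvd_prod_prime_powers:
  fixes q \<alpha> :: "'i \<Rightarrow> nat"
  assumes "finite I" "\<And>i. i \<in> I \<Longrightarrow> prime (q i)" "a dvd (\<Prod>i\<in>I. q i ^ \<alpha> i)"
  obtains r where "r \<in> (\<Pi>\<^sub>E i\<in>I. {0..\<alpha> i})" "a = (\<Prod>i\<in>I. q i ^ r i)"
proof -
  have "\<exists>r. (\<forall>i\<in>I. r i \<le> \<alpha> i) \<and> a = (\<Prod>i\<in>I. q i ^ r i)"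
    using assms
  proof (induction I arbitrary: a rule: finite_induct)
    case (insert j I)
    then have "a dvd q j ^ \<alpha> j * (\<Prod>i\<in>I. q i ^ \<alpha> i)" by simp
    then obtain b c where bc: "a = b * c" "b dvd q j ^ \<alpha> j" "c dvd (\<Prod>i\<in>I. q i ^ \<alpha> i)"
      using division_decomp by blast
    obtain e where e: "e \<le> \<alpha> j" "b = q j ^ e" using bc(2) insert.prems(1)[of j] divides_primepow_nat by auto
    obtain r where r: "\<forall>i\<in>I. r i \<le> \<alpha> i" "c = (\<Prod>i\<in>I. q i ^ r i)" using insert.IH bc(3) insert.prems(1) by blast
    have "(\<Prod>i\<in>I. q i ^ (r(j := e)) i) = c"
      unfolding r(2) using insert.hyps by (intro prod.cong) auto
    then show ?case using bc e r insert.hyps by (intro exI[of _ "r(j := e)"]) auto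
  qed auto
  then obtain r where r: "\<forall>i\<in>I. r i \<le> \<alpha> i" "a = (\<Prod>i\<in>I. q i ^ r i)" by blast
  then show thesis by (intro that[of "restrict r I"]) auto
qed

section \<open>Subgroups giving wavelet frames\<close>

theorem theorem4p4:
  fixes p k :: nat and y :: "int \<Rightarrow> complex" and q \<alpha> :: "nat \<Rightarrow> nat" and \<epsilon> :: int
  assumes "prime p"
    and "y \<in> Cp p"
    and "dft p y 0 \<noteq> 0"
    and "k \<ge> 1"
    and "\<And>i. i \<in> {1..k} \<Longrightarrow> prime (q i)"
    and "strict_mono_on {1..k} q"
    and "totient p = (\<Prod>i=1..k. q i ^ \<alpha> i)"
    and "\<epsilon> \<in> carrier (Up p)"
    and "generate (Up p) {\<epsilon>} = carrier (Up p)"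
  shows "{M. subgroup M (Up p) \<and> wavelet_frame p y (M \<times> carrier (Zp p))} =
         {generate (Up p) {\<epsilon> [^]\<^bsub>Up p\<^esub> (\<Prod>i=1..k. q i ^ (r i - s i))} | r s.
            r \<in> Lambda p \<epsilon> y k q \<alpha> \<and> s \<in> (\<Pi>\<^sub>E i\<in>{1..k}. {0..r i})} \<and>
         (\<forall>r\<in>Lambda p \<epsilon> y k q \<alpha>. \<forall>s\<in>(\<Pi>\<^sub>E i\<in>{1..k}. {0..r i}).
            card (generate (Up p) {\<epsilon> [^]\<^bsub>Up p\<^esub> (\<Prod>i=1..k. q i ^ (r i - s i))}) =
            (\<Prod>i=1..k. q i ^ (\<alpha> i - r i + s i)))"
proof -
  note p = \<open>prime p\<close> and \<epsilon> = \<open>\<epsilon> \<in> carrier (Up p)\<close> and gen = \<open>generate (Up p) {\<epsilon>} = carrier (Up p)\<close>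
  interpret U: group "Up p" using group_Up[OF p] .
  let ?pow = "\<lambda>n::nat. \<epsilon> [^]\<^bsub>Up p\<^esub> n"
  let ?P = "\<lambda>e. \<Prod>i=1..k. q i ^ e i"
  have fin: "finite (carrier (Up p))" by simp
  have tot: "p - 1 = ?P \<alpha>" using assms(7) p by (simp add: totient_prime)
  have ord: "U.ord \<epsilon> = ?P \<alpha>"
    unfolding U.generate_pow_card[OF \<epsilon>] gen card_Up by (rule tot)
  have P_pos: "?P e > 0" for e using assms(5) prime_gt_0_nat by (intro prod_pos) simp
  have P_dvd: "?P e dvd ?P f" if "\<And>i. i \<in> {1..k} \<Longrightarrow> e i \<le> f i" for e f
    using that by (intro prod_dvd_prod le_imp_power_dvd)
  (* A tuple is in Lambda exactly when its own subgroup, the case s = 0, gives a frame. *)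
  have Lambda_iff: "r \<in> Lambda p \<epsilon> y k q \<alpha> \<longleftrightarrow>
      r \<in> (\<Pi>\<^sub>E i\<in>{1..k}. {0..\<alpha> i}) \<and>
      wavelet_frame p y (generate (Up p) {?pow (?P r)} \<times> carrier (Zp p))" for r
  proof (cases "r \<in> (\<Pi>\<^sub>E i\<in>{1..k}. {0..\<alpha> i})")
    case True
    then have "?P r dvd p - 1" unfolding tot by (intro P_dvd) (auto dest: PiE_mem)
    from frame_iff_nonzero_rows[OF p \<epsilon> gen \<open>dft p y 0 \<noteq> 0\<close> this] True
    show ?thesis by (auto simp: Lambda_def)
  qed (simp add: Lambda_def)
  have "{M. subgroup M (Up p) \<and> wavelet_frame p y (M \<times> carrier (Zp p))} =
         {generate (Up p) {?pow (\<Prod>i=1..k. q i ^ (r i - s i))} | r s.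
            r \<in> Lambda p \<epsilon> y k q \<alpha> \<and> s \<in> (\<Pi>\<^sub>E i\<in>{1..k}. {0..r i})}" (is "?L = ?R")
  proof (intro equalityI subsetI)
    fix M assume "M \<in> ?L"
    then have M: "subgroup M (Up p)" "wavelet_frame p y (M \<times> carrier (Zp p))" by auto
    obtain a where a: "a dvd U.ord \<epsilon>" "M = generate (Up p) {?pow a}"
      using U.subgroup_of_cyclic_group[OF fin \<epsilon> gen M(1)] by blast
    obtain r where r: "r \<in> (\<Pi>\<^sub>E i\<in>{1..k}. {0..\<alpha> i})" "a = ?P r"
      using dvd_prod_prime_powers[of "{1..k}" q a \<alpha>] assms(5) a(1) unfolding ord by auto
    define s where "s = (\<lambda>i\<in>{1..k}. 0::nat)"
    have "(\<Prod>i=1..k. q i ^ (r i - s i)) = a" unfolding r(2) by (intro prod.cong) (auto simp: s_def)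
    moreover have "r \<in> Lambda p \<epsilon> y k q \<alpha>" unfolding Lambda_iff using r a M by simp
    moreover have "s \<in> (\<Pi>\<^sub>E i\<in>{1..k}. {0..r i})" by (simp add: s_def)
    ultimately show "M \<in> ?R" using a(2) by blast
  next
    fix M assume "M \<in> ?R"
    then obtain r s where M: "M = generate (Up p) {?pow (\<Prod>i=1..k. q i ^ (r i - s i))}"
      and r: "r \<in> Lambda p \<epsilon> y k q \<alpha>" by auto
    define b where "b = (\<Prod>i=1..k. q i ^ (r i - s i))"
    define N where "N = generate (Up p) {?pow (?P r)}"
    have Msub: "subgroup M (Up p)" unfolding M using U.nat_pow_closed[OF \<epsilon>] by (intro U.generate_is_subgroup) blast
    have "b dvd ?P r" unfolding b_def by (rule P_dvd) simp
    then obtain j where "?P r = b * j" by auto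
    then have "?pow (?P r) \<in> M"
      unfolding M b_def[symmetric] using U.pow_mult_in_generate[OF fin \<epsilon>] by simp
    then have NM: "N \<subseteq> M" unfolding N_def using U.generate_subgroup_incl[of "{?pow (?P r)}" M] Msub by auto
    have MU: "M \<subseteq> carrier (Up p)" using Msub by (rule subgroup.subset)
    have "wavelet_frame p y (N \<times> carrier (Zp p))" using r unfolding Lambda_iff N_def by simp
    then have "wavelet_frame p y (M \<times> carrier (Zp p))"
      using NM wavelet_frame_iff[OF p MU] wavelet_frame_iff[OF p, of N] MU by blast
    then show "M \<in> ?L" using Msub by simp
  qed
  moreover have "card (generate (Up p) {?pow (\<Prod>i=1..k. q i ^ (r i - s i))}) =
            (\<Prod>i=1..k. q i ^ (\<alpha> i - r i + s i))"
    if r: "r \<in> Lambda p \<epsilon> y k q \<alpha>" and s: "s \<in> (\<Pi>\<^sub>E i\<in>{1..k}. {0..r i})" for r s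
  proof -
    have r\<alpha>: "r i \<le> \<alpha> i" and sr: "s i \<le> r i" if "i \<in> {1..k}" for i
      using r s that by (auto simp: Lambda_def dest!: PiE_mem)
    let ?b = "\<Prod>i=1..k. q i ^ (r i - s i)" and ?c = "\<Prod>i=1..k. q i ^ (\<alpha> i - r i + s i)"
    have bc: "?b * ?c = ?P \<alpha>"
      unfolding prod.distrib[symmetric] power_add[symmetric]
      using r\<alpha> sr by (intro prod.cong refl arg_cong2[where f = power]) fastforce
    then have "card (generate (Up p) {?pow ?b}) = ?P \<alpha> div ?b"
      using U.generate_pow_dvd_ord(2)[OF fin \<epsilon>, of ?b] unfolding ord by (metis dvd_triv_left)
    also have "\<dots> = ?c"
      unfolding bc[symmetric] using P_pos[of "\<lambda>i. r i - s i", THEN gr_implies_not0]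
      by (rule nonzero_mult_div_cancel_left)
    finally show ?thesis .
  qed
  ultimately show ?thesis by blast
qed

end
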